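(* For each positive integer $n$, let $\mathcal{G}_n$ be the set of all simple undirected labeled graphs on the vertex set $\{1,\ldots,n\}$ (so $|\mathcal{G}_n|=2^{\binom{n}{2}}$), and let $$\alpha_n(\mathbb{F}_2)=\frac{1}{n\,2^{\binom{n}{2}}}\sum_{G\in\mathcal{G}_n}\mathrm{mr}(\mathbb{F}_2,G).$$ Let $\underline{\alpha}(\mathbb{F}_2)=\liminf_{n\to\infty}\alpha_n(\mathbb{F}_2)$ and $\overline{\alpha}(\mathbb{F}_2)=\limsup_{n\to\infty}\alpha_n(\mathbb{F}_2)$. Then $$\underline{\alpha}(\mathbb{F}_2)=\overline{\alpha}(\mathbb{F}_2)=1.$$
   Context: $\mathbb{F}_2$ is the field with two elements. For a field $\mathbb{F}$ and a simple undirected graph $G$ with vertex set $\{1,\ldots,n\}$ and edge set $E$, let $\mathrm{S}(\mathbb{F},G)$ denote the set of all symmetric $n\times n$ matrices $A=[a_{ij}]$ over $\mathbb{F}$ such that, for all $i\neq j$, $a_{ij}\neq 0$ if and only if $ij\in E$; there is no restriction on the diagonal entries. The minimum rank of $G$ over $\mathbb{F}$ is $\mathrm{mr}(\mathbb{F},G)=\min\{\operatorname{rank}A : A\in \mathrm{S}(\mathbb{F},G)\}$. *)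

theory Defs
  imports
    "Graph_Theory.Pair_Digraph"
    "Jordan_Normal_Form.DL_Rank"
    "HOL-Library.Z2"
    "HOL-Library.Extended_Real"
begin

text \<open>
  A simple undirected graph is a \<^const>\<open>pair_graph\<close>: a finite, loop-free, symmetric digraph
  whose arcs are pairs of vertices, so an edge \<open>ij\<close> is the pair of arcs \<open>(i, j)\<close> and \<open>(j, i)\<close>.
\<close>

definition labeled_graphs :: "nat \<Rightarrow> nat pair_pre_digraph set" where
  "labeled_graphs n = {G. pair_graph G \<and> pverts G = {1..n}}"

text \<open>
  Matrix indices start at \<open>0\<close> while vertices start at \<open>1\<close>, hence the index shift. The
  definition is meant for graphs with vertex set \<open>{1..n}\<close>, where \<open>n = card (pverts G)\<close>.
\<close>

definition graph_matrices :: "nat pair_pre_digraph \<Rightarrow> 'f::field mat set" where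
  "graph_matrices G =
     {A \<in> carrier_mat (card (pverts G)) (card (pverts G)).
        transpose_mat A = A \<and>
        (\<forall>i\<in>pverts G. \<forall>j\<in>pverts G. i \<noteq> j \<longrightarrow>
           (A $$ (i - 1, j - 1) \<noteq> 0 \<longleftrightarrow> (i, j) \<in> parcs G))}"

definition min_rank :: "'f::field itself \<Rightarrow> nat pair_pre_digraph \<Rightarrow> nat" where
  "min_rank _ G =
     Min (vec_space.rank (card (pverts G)) ` (graph_matrices G :: 'f mat set))"

text \<open>The two-element field is the type \<^typ>\<open>bit\<close> of \<^theory>\<open>HOL-Library.Z2\<close>.\<close>

definition avg_min_rank :: "'f::field itself \<Rightarrow> nat \<Rightarrow> real" where
  "avg_min_rank F n =
     (\<Sum>G\<in>labeled_graphs n. real (min_rank F G)) / (real n * 2 ^ (n choose 2))"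

text \<open>The minimum in \<^const>\<open>min_rank\<close> ranges over a finite nonempty set.\<close>

lemma min_rank_attained:
  assumes "G \<in> labeled_graphs n"
  shows "finite (vec_space.rank n ` (graph_matrices G :: 'f::field mat set))"
    and "(graph_matrices G :: 'f mat set) \<noteq> {}"
proof -
  have V: "pverts G = {1..n}" and G: "pair_graph G"
    using assms by (auto simp: labeled_graphs_def)
  have c: "card (pverts G) = n" using V by simp
  have "vec_space.rank n ` (graph_matrices G :: 'f mat set) \<subseteq> {..n}"
    by (auto simp: graph_matrices_def c intro: vec_space.rank_le_nc)
  then show "finite (vec_space.rank n ` (graph_matrices G :: 'f mat set))"
    by (rule finite_subset) simp
  have "symmetric (with_proj G)"
    using G by (simp add: pair_graph_def pair_pseudo_graph_def pair_sym_digraph_def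
        pair_sym_digraph_axioms_def)
  then have s: "(i, j) \<in> parcs G \<longleftrightarrow> (j, i) \<in> parcs G" for i j
    by (auto simp: symmetric_def sym_def)
  have "mat n n (\<lambda>(i, j). if (i + 1, j + 1) \<in> parcs G then 1 else 0) \<in>
      (graph_matrices G :: 'f mat set)"
    unfolding graph_matrices_def c by (auto simp: V s intro!: eq_matI split: if_splits)
  then show "(graph_matrices G :: 'f mat set) \<noteq> {}" by blast
qed

lemma card_labeled_graphs: "card (labeled_graphs n) = 2 ^ (n choose 2)"
proof -
  define P where "P = {e. e \<subseteq> {1..n} \<and> card e = 2}"
  have finP: "finite P" unfolding P_def by (rule finite_subset[of _ "Pow {1..n}"]) auto
  define f :: "nat pair_pre_digraph \<Rightarrow> nat set set"
    where "f G = {{i, j} | i j. (i, j) \<in> parcs G}" for G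
  define g :: "nat set set \<Rightarrow> nat pair_pre_digraph"
    where "g E = \<lparr>pverts = {1..n}, parcs = {(i, j). i \<noteq> j \<and> {i, j} \<in> E}\<rparr>" for E
  have graph: "wf G" "sy G" "lf G"
    if "G \<in> labeled_graphs n" "wf = (\<lambda>G. \<forall>(i, j)\<in>parcs G. i \<in> {1..n} \<and> j \<in> {1..n})"
      "sy = (\<lambda>G. \<forall>i j. (i, j) \<in> parcs G \<longrightarrow> (j, i) \<in> parcs G)"
      "lf = (\<lambda>G. \<forall>(i, j)\<in>parcs G. i \<noteq> j)" for G wf sy lf
  proof -
    have V: "pverts G = {1..n}" using that by (simp add: labeled_graphs_def)
    interpret pair_graph G using that by (simp add: labeled_graphs_def)
    show "wf G" using V in_arcsD1 in_arcsD2 by (auto simp: that)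
    show "sy G" using pair_sym_arcs by (auto simp: that symmetric_def sym_def)
    show "lf G" using pair_no_loops by (fastforce simp: that)
  qed
  have "bij_betw f (labeled_graphs n) (Pow P)"
  proof (rule bij_betw_byWitness[where f' = g])
    show "\<forall>G\<in>labeled_graphs n. g (f G) = G"
    proof
      fix G assume G: "G \<in> labeled_graphs n"
      have V: "pverts G = {1..n}" using G by (simp add: labeled_graphs_def)
      show "g (f G) = G"
        unfolding g_def f_def
        by (rule pair_pre_digraph.equality)
          (use graph[OF G refl refl refl] V in \<open>auto simp: doubleton_eq_iff\<close>)
    qed
    show "\<forall>E\<in>Pow P. f (g E) = E"
    proof
      fix E assume E: "E \<in> Pow P"
      have "\<exists>i j. e = {i, j} \<and> i \<noteq> j" if "e \<in> E" for e
        using E that by (auto simp: P_def card_2_iff)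
      then show "f (g E) = E" unfolding f_def g_def by fastforce
    qed
    show "f ` labeled_graphs n \<subseteq> Pow P"
      using graph[OF _ refl refl refl] unfolding f_def P_def by (fastforce simp: card_2_iff)
    show "g ` Pow P \<subseteq> labeled_graphs n"
    proof
      fix G assume "G \<in> g ` Pow P"
      then obtain E where E: "E \<subseteq> P" and G: "G = g E" by blast
      have fin: "finite (parcs G)"
        by (rule finite_subset[of _ "{1..n} \<times> {1..n}"]) (use E in \<open>auto simp: G g_def P_def\<close>)
      have "pair_graph G"
        by unfold_locales
          (use E fin in \<open>auto simp: G g_def P_def symmetric_def sym_def insert_commute\<close>)
      then show "G \<in> labeled_graphs n" by (simp add: labeled_graphs_def G g_def)
    qed
  qed
  then have "card (labeled_graphs n) = card (Pow P)" by (rule bij_betw_same_card)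
  also have "\<dots> = 2 ^ (n choose 2)"
    using n_subsets[of "{1..n}" 2] by (simp add: card_Pow finP P_def)
  finally show ?thesis .
qed

end

theory Submission
  imports Defs "HOL-Real_Asymp.Real_Asymp"
begin

text \<open>
  If the columns indexed by \<open>I\<close> span the column space of a symmetric matrix, then the matrix is
  determined by its entries in these columns. Taking \<open>card I\<close> to be the rank and encoding a
  matrix over the two-element field by \<open>I\<close> and the entries on or above the diagonal that meet the
  rows or columns in \<open>I\<close>, one sees that at most \<open>2 ^ (n + n (n + 1) / 2 - m\<^sup>2 / 2)\<close> symmetric
  matrices have rank at most \<open>n - m\<close>. For \<open>m = \<lceil>sqrt (6 n)\<rceil>\<close> this is a proportion of at most
  \<open>2 ^ - n\<close> of the number of graphs, so almost every graph has minimum rank above \<open>n - m\<close>, where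
  \<open>m = o(n)\<close>.
\<close>

section \<open>Linear algebra: spanning columns and the recovery of a symmetric matrix\<close>

text \<open>A maximal linearly independent set \<open>S\<close> of columns spans every column, since
  a column outside its span could be added. Its size is the rank. Choosing one index for each vector
  of \<open>S\<close> gives \<open>I\<close>, so repeated columns are counted once.\<close>

lemma (in vec_space) spanning_columns:
  assumes A: "A \<in> carrier_mat n nc"
  obtains I c where "I \<subseteq> {..<nc}" "card I = rank A"
    "\<And>i j. i < n \<Longrightarrow> j < nc \<Longrightarrow> A $$ (i, j) = (\<Sum>k\<in>I. c j k * A $$ (i, k))"
proof -
  let ?P = "\<lambda>T. T \<subseteq> set (cols A) \<and> lin_indpt T"
  obtain S where S: "maximal S ?P" "finite S"
    using maximal_exists_superset[of "set (cols A)" ?P "{}"] finite_lin_indpt2 by auto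
  have sub: "S \<subseteq> set (cols A)" and ind: "lin_indpt S"
    using S(1) by (auto simp: maximal_def)
  have carr: "set (cols A) \<subseteq> carrier_vec n" using cols_dim A by blast
  have span: "v \<in> span S" if v: "v \<in> set (cols A)" for v
  proof (rule ccontr)
    assume nv: "v \<notin> span S"
    then have "v \<notin> S" using span_mem sub carr by auto
    moreover have "lin_indpt (insert v S)"
      using lin_dep_iff_in_span[of S v] sub ind carr v nv \<open>v \<notin> S\<close> by auto
    ultimately show False
      using S(1) v sub unfolding maximal_def by (metis insertI1 insert_subset subset_insertI)
  qed
  have colsA: "set (cols A) = col A ` {..<nc}"
    using A by (auto simp: cols_def)
  then obtain I where I: "I \<subseteq> {..<nc}" "inj_on (col A) I" "S = col A ` I"
    using sub subset_image_inj by metis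
  have "\<exists>c. \<forall>i<n. A $$ (i, j) = (\<Sum>k\<in>I. c k * A $$ (i, k))" if j: "j < nc" for j
  proof -
    have "col A j \<in> span S" using span j colsA by auto
    then obtain a T where T: "col A j = lincomb a T" "T \<subseteq> S" "finite T"
      unfolding span_def by auto
    \<comment> \<open>The coefficients of \<open>lincomb\<close> belong to vectors in
      \<open>T\<close>. They are extended by zero to \<open>S\<close> and pulled back to indices
      along \<open>col A\<close>, which is injective on \<open>I\<close>.\<close>
    let ?c = "\<lambda>k. if col A k \<in> T then a (col A k) else 0"
    have "A $$ (i, j) = (\<Sum>k\<in>I. ?c k * A $$ (i, k))" if i: "i < n" for i
    proof -
      have "A $$ (i, j) = lincomb a T $ i"
        using A i j T(1) by (metis carrier_matD index_col)
      also have "\<dots> = (\<Sum>x\<in>T. a x * x $ i)"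
        using lincomb_index[OF i] T(2) sub carr by (meson subset_trans)
      also have "\<dots> = (\<Sum>x\<in>S. (if x \<in> T then a x else 0) * x $ i)"
        using T(2) S(2) by (intro sum.mono_neutral_cong_left) auto
      also have "\<dots> = (\<Sum>k\<in>I. ?c k * col A k $ i)"
        unfolding I(3) by (subst sum.reindex[OF I(2)]) simp
      also have "\<dots> = (\<Sum>k\<in>I. ?c k * A $$ (i, k))"
        using A I(1) i by (intro sum.cong) auto
      finally show ?thesis .
    qed
    then show ?thesis by (intro exI[of _ ?c] allI impI)
  qed
  then obtain c where "\<And>i j. i < n \<Longrightarrow> j < nc \<Longrightarrow> A $$ (i, j) = (\<Sum>k\<in>I. c j k * A $$ (i, k))"
    by metis
  moreover have "card I = rank A"
    using rank_card_indpt[OF A S(1)] I by (simp add: card_image)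
  ultimately show ?thesis using that I(1) by blast
qed

text \<open>The coefficients \<open>c\<close> and \<open>d\<close> may differ. Both entries equal
  the double sum of \<open>c j k * d i l * a l k\<close> over \<open>k\<close> and \<open>l\<close>
  in \<open>I\<close>: summing over \<open>l\<close> first gives \<open>a i j\<close>, summing over
  \<open>k\<close> first gives \<open>b i j\<close>.\<close>

lemma symmetric_eq_if_spanning_columns_eq:
  fixes a b c d :: "'i \<Rightarrow> 'i \<Rightarrow> 'f::comm_ring"
  assumes "I \<subseteq> N"
    and a: "\<And>i j. i \<in> N \<Longrightarrow> j \<in> N \<Longrightarrow> a i j = a j i"
    and b: "\<And>i j. i \<in> N \<Longrightarrow> j \<in> N \<Longrightarrow> b i j = b j i"
    and c: "\<And>i j. i \<in> N \<Longrightarrow> j \<in> N \<Longrightarrow> a i j = (\<Sum>k\<in>I. c j k * a i k)"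
    and d: "\<And>i j. i \<in> N \<Longrightarrow> j \<in> N \<Longrightarrow> b i j = (\<Sum>k\<in>I. d j k * b i k)"
    and eq: "\<And>i k. i \<in> N \<Longrightarrow> k \<in> I \<Longrightarrow> a i k = b i k"
    and i: "i \<in> N" and j: "j \<in> N"
  shows "a i j = b i j"
proof -
  note IN = subsetD[OF \<open>I \<subseteq> N\<close>]
  have "a i j = (\<Sum>k\<in>I. c j k * (\<Sum>l\<in>I. d i l * a l k))"
    unfolding c[OF i j]
  proof (intro sum.cong refl arg_cong[where f = "(*) _"])
    fix k assume k: "k \<in> I"
    \<comment> \<open>Symmetry turns \<open>i\<close> into a column index, where the expansion of
      \<open>b\<close> applies. What remains has both indices in \<open>I\<close>, where
      \<open>b\<close> can be replaced by \<open>a\<close>.\<close>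
    have "a i k = b k i" using eq i k b IN by simp
    also have "\<dots> = (\<Sum>l\<in>I. d i l * b k l)" using d k i IN by blast
    also have "\<dots> = (\<Sum>l\<in>I. d i l * a l k)"
      using eq a k IN by (intro sum.cong refl arg_cong[where f = "(*) _"]) metis
    finally show "a i k = (\<Sum>l\<in>I. d i l * a l k)" .
  qed
  also have "\<dots> = (\<Sum>l\<in>I. d i l * (\<Sum>k\<in>I. c j k * a l k))"
    unfolding sum_distrib_left by (subst sum.swap) (simp add: algebra_simps)
  also have "\<dots> = (\<Sum>l\<in>I. d i l * b j l)"
  proof (intro sum.cong refl arg_cong[where f = "(*) _"])
    fix l assume l: "l \<in> I"
    show "(\<Sum>k\<in>I. c j k * a l k) = b j l"
      using c[of l j] a[of l j] eq[of j l] l j IN by simp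
  qed
  also have "\<dots> = b i j" using d[OF j i] b i j by simp
  finally show ?thesis .
qed

section \<open>Counting matrix positions on or above the diagonal\<close>

lemma card_le_pairs: "card {(i, j). i \<le> j \<and> j < n} = (n choose 2) + (n::nat)"
proof -
  have "{(i, j). i \<le> j \<and> j < n} = (\<lambda>(j, i). (i, j)) ` (SIGMA j:{..<n}. {..j})"
    by (auto simp: image_iff)
  then have "card {(i, j). i \<le> j \<and> j < n} = card (SIGMA j:{..<n}. {..j})"
    by (simp add: card_image inj_on_def split_beta prod_eq_iff)
  also have "\<dots> = (\<Sum>j<n. Suc j)" by simp
  also have "\<dots> = (n choose 2) + n"
    by (induction n) (simp_all add: numeral_2_eq_2)
  finally show ?thesis .
qed

text \<open>The triangle and its mirror image cover the square \<open>J \<times> J\<close>.\<close>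

lemma card_le_pairs_in_ge:
  fixes J :: "'a::linorder set"
  assumes "finite J"
  shows "(card J)\<^sup>2 \<le> 2 * card {(i, j). i \<le> j \<and> i \<in> J \<and> j \<in> J}"
proof -
  let ?T = "{(i, j). i \<le> j \<and> i \<in> J \<and> j \<in> J}"
  have fin: "finite ?T"
    by (rule finite_subset[of _ "J \<times> J"]) (use assms in auto)
  have "J \<times> J \<subseteq> ?T \<union> prod.swap ` ?T"
    by (force simp: image_iff)
  then have "card (J \<times> J) \<le> card (?T \<union> prod.swap ` ?T)"
    using fin by (intro card_mono) auto
  also have "\<dots> \<le> card ?T + card (prod.swap ` ?T)" by (rule card_Un_le)
  also have "\<dots> \<le> 2 * card ?T" using card_image_le[OF fin, of prod.swap] by simp
  finally show ?thesis by (simp add: card_cartesian_product power2_eq_square)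
qed

text \<open>The pairs that avoid \<open>I\<close> form the triangle over the complement of
  \<open>I\<close>, which has at least \<open>m\<close> elements. Doubling avoids division of
  natural numbers.\<close>

lemma card_pairs_meeting:
  assumes I: "I \<subseteq> {..<n}" and m: "card I + m \<le> n"
  shows "2 * card {(i, j). i \<le> j \<and> j < n \<and> (i \<in> I \<or> j \<in> I)} + m\<^sup>2 \<le> 2 * ((n choose 2) + n)"
proof -
  let ?J = "{..<n} - I"
  let ?P = "{(i, j). i \<le> j \<and> j < n \<and> (i \<in> I \<or> j \<in> I)}"
  let ?T = "{(i, j). i \<le> j \<and> i \<in> ?J \<and> j \<in> ?J}"
  have "finite ?P" "finite ?T"
    by (rule finite_subset[of _ "{..<n} \<times> {..<n}"]; auto)+
  moreover have "?P \<inter> ?T = {}" by auto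
  moreover have "?P \<union> ?T = {(i, j). i \<le> j \<and> j < n}" by auto
  ultimately have "card ?P + card ?T = (n choose 2) + n"
    using card_Un_disjoint[of ?P ?T] card_le_pairs[of n] by simp
  moreover have "m \<le> card ?J"
    using I m by (simp add: card_Diff_subset finite_subset[OF I])
  then have "m\<^sup>2 \<le> 2 * card ?T"
    using card_le_pairs_in_ge[of ?J] power_mono[of m "card ?J" 2]
    by (meson finite_Diff finite_lessThan le_trans zero_le)
  ultimately show ?thesis by simp
qed

section \<open>Counting symmetric matrices of low rank over the two-element field\<close>

text \<open>Here \<open>m\<close> is a lower bound on the corank. Written as a sum, the condition is
  unsatisfiable for \<open>m > n\<close>, where the difference \<open>n - m\<close> would be
  truncated to zero.\<close>

definition low_rank_symmetric :: "nat \<Rightarrow> nat \<Rightarrow> bit mat set" where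
  "low_rank_symmetric n m =
     {A \<in> carrier_mat n n. transpose_mat A = A \<and> vec_space.rank n A + m \<le> n}"

lemma card_low_rank_symmetric:
  assumes m: "6 * n \<le> m\<^sup>2"
  shows "finite (low_rank_symmetric n m)"
    and "card (low_rank_symmetric n m) * 2 ^ n \<le> 2 ^ (n choose 2)"
proof -
  define P where "P I = {(i, j). i \<le> j \<and> j < n \<and> (i \<in> I \<or> j \<in> I)}" for I :: "nat set"
  define Q where "Q = {I. I \<subseteq> {..<n} \<and> card I + m \<le> n}"
  define spanned where "spanned A I \<longleftrightarrow> I \<in> Q \<and>
     (\<exists>c. \<forall>i<n. \<forall>j<n. A $$ (i, j) = (\<Sum>k\<in>I. c j k * A $$ (i, k)))" for A :: "bit mat" and I
  have "\<exists>I. spanned A I" if "A \<in> low_rank_symmetric n m" for A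
  proof -
    have A: "A \<in> carrier_mat n n" "vec_space.rank n A + m \<le> n"
      using that by (auto simp: low_rank_symmetric_def)
    obtain J c where J: "J \<subseteq> {..<n}" "card J = vec_space.rank n A"
      and c: "\<And>i j. i < n \<Longrightarrow> j < n \<Longrightarrow> A $$ (i, j) = (\<Sum>k\<in>J. c j k * A $$ (i, k))"
      using vec_space.spanning_columns[OF A(1)] by metis
    have "J \<in> Q" using J A(2) by (simp add: Q_def)
    then show ?thesis unfolding spanned_def using c by blast
  qed
  then obtain I where I: "\<And>A. A \<in> low_rank_symmetric n m \<Longrightarrow> spanned A (I A)" by metis
  \<comment> \<open>The code of \<open>A\<close> is its chosen index set with the positions in
    \<open>P (I A)\<close> of the ones; over two elements these positions determine the entries
    there.\<close>
  define f where "f A = (I A, {(i, j) \<in> P (I A). A $$ (i, j) = 1})" for A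
  have finP: "finite (P J)" for J
    unfolding P_def by (rule finite_subset[of _ "{..<n} \<times> {..<n}"]) auto
  have finQ: "finite Q"
    unfolding Q_def by (rule finite_subset[of _ "Pow {..<n}"]) auto
  have inj: "inj_on f (low_rank_symmetric n m)"
  proof (rule inj_onI)
    fix A B assume AB: "A \<in> low_rank_symmetric n m" "B \<in> low_rank_symmetric n m" "f A = f B"
    have A: "A \<in> carrier_mat n n" "transpose_mat A = A"
      and B: "B \<in> carrier_mat n n" "transpose_mat B = B"
      using AB by (auto simp: low_rank_symmetric_def)
    have symA: "A $$ (i, j) = A $$ (j, i)" if "i < n" "j < n" for i j
      using A that by (metis carrier_matD index_transpose_mat(1))
    have symB: "B $$ (i, j) = B $$ (j, i)" if "i < n" "j < n" for i j
      using B that by (metis carrier_matD index_transpose_mat(1))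
    have IB: "I B = I A" and bits: "{(i, j) \<in> P (I A). A $$ (i, j) = 1} =
        {(i, j) \<in> P (I A). B $$ (i, j) = 1}"
      using AB(3) by (auto simp: f_def)
    have IQ: "I A \<in> Q" using I[OF AB(1)] by (simp add: spanned_def)
    obtain c where c: "\<And>i j. i < n \<Longrightarrow> j < n \<Longrightarrow> A $$ (i, j) = (\<Sum>k\<in>I A. c j k * A $$ (i, k))"
      using I[OF AB(1)] unfolding spanned_def by blast
    obtain d where d: "\<And>i j. i < n \<Longrightarrow> j < n \<Longrightarrow> B $$ (i, j) = (\<Sum>k\<in>I A. d j k * B $$ (i, k))"
      using I[OF AB(2)] unfolding IB spanned_def by blast
    have P: "A $$ (i, j) = B $$ (i, j)" if "(i, j) \<in> P (I A)" for i j
    proof -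
      have "A $$ (i, j) = 1 \<longleftrightarrow> B $$ (i, j) = 1" using bits that by auto
      then show ?thesis by (metis bit_not_one_iff)
    qed
    \<comment> \<open>\<open>P\<close> holds only positions on or above the diagonal; the lower
      parts of the columns in \<open>I A\<close> follow by symmetry.\<close>
    have agree: "A $$ (i, k) = B $$ (i, k)" if "i < n" "k \<in> I A" for i k
    proof -
      have k: "k < n" using IQ that by (auto simp: Q_def)
      show ?thesis
      proof (cases "i \<le> k")
        case True
        then show ?thesis using P that k by (simp add: P_def)
      next
        case False
        then have "A $$ (k, i) = B $$ (k, i)" using P that k by (simp add: P_def)
        then show ?thesis using symA symB that k by metis
      qed
    qed
    show "A = B"
    proof (rule eq_matI)
      fix i j assume "i < dim_row B" "j < dim_col B"
      then have "i \<in> {..<n}" "j \<in> {..<n}" using B by auto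
      moreover have "I A \<subseteq> {..<n}" using IQ by (simp add: Q_def)
      ultimately show "A $$ (i, j) = B $$ (i, j)"
        using symmetric_eq_if_spanning_columns_eq[of "I A" "{..<n}" "\<lambda>i j. A $$ (i, j)"
            "\<lambda>i j. B $$ (i, j)" c d i j, unfolded lessThan_iff, OF _ symA symB c d agree]
        by blast
    qed (use A B in auto)
  qed
  have img: "f ` low_rank_symmetric n m \<subseteq> (SIGMA J:Q. Pow (P J))"
    using I by (auto simp: f_def spanned_def)
  have finS: "finite (SIGMA J:Q. Pow (P J))" using finP finQ by auto
  show "finite (low_rank_symmetric n m)"
    using inj finS img by (meson finite_imageD finite_subset)
  \<comment> \<open>Of the \<open>6 * n\<close> below \<open>m\<^sup>2\<close>, the diagonal uses up
    \<open>2 * n\<close>; half of the rest is \<open>n + n\<close>. One \<open>n\<close> pays for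
    the at most \<open>2 ^ n\<close> sets in \<open>Q\<close>, the other is the gain in the
    conclusion.\<close>
  have pow: "2 ^ card (P J) * 2 ^ (n + n) \<le> (2 ^ (n choose 2) :: nat)" if "J \<in> Q" for J
  proof -
    have "card (P J) + (n + n) \<le> n choose 2"
      using card_pairs_meeting[of J n m] that m by (simp add: P_def Q_def)
    then have "2 ^ (card (P J) + (n + n)) \<le> (2 ^ (n choose 2) :: nat)"
      by (intro power_increasing) auto
    then show ?thesis by (simp add: power_add)
  qed
  have "card (low_rank_symmetric n m) \<le> card (SIGMA J:Q. Pow (P J))"
    using card_inj_on_le[OF inj img finS] .
  also have "\<dots> = (\<Sum>J\<in>Q. 2 ^ card (P J))"
    using finP finQ by (simp add: card_Pow)
  finally have "card (low_rank_symmetric n m) * 2 ^ (n + n)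
      \<le> (\<Sum>J\<in>Q. 2 ^ card (P J) * 2 ^ (n + n))"
    by (simp add: sum_distrib_right[symmetric])
  also have "\<dots> \<le> card Q * 2 ^ (n choose 2)"
    using sum_bounded_above[of Q, OF pow] by simp
  also have "\<dots> \<le> 2 ^ n * 2 ^ (n choose 2)"
    using card_mono[of "Pow {..<n}" Q] by (auto simp: Q_def card_Pow)
  finally show "card (low_rank_symmetric n m) * 2 ^ n \<le> 2 ^ (n choose 2)"
    by (simp add: power_add)
qed

section \<open>From matrices to graphs\<close>

lemma min_rank_witness:
  assumes "G \<in> labeled_graphs n"
  obtains A :: "'f::field mat" where "A \<in> graph_matrices G"
    "min_rank TYPE('f) G = vec_space.rank n A"
proof -
  have "card (pverts G) = n" using assms by (simp add: labeled_graphs_def)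
  then have "min_rank TYPE('f) G \<in> vec_space.rank n ` (graph_matrices G :: 'f mat set)"
    unfolding min_rank_def using min_rank_attained[OF assms, where 'f = 'f] by (auto intro!: Min_in)
  then show ?thesis using that by blast
qed

text \<open>The off-diagonal zero pattern of a matrix determines the graph, so a count of matrices
  bounds a count of graphs.\<close>

lemma graph_matrices_inj:
  assumes G: "G \<in> labeled_graphs n" and H: "H \<in> labeled_graphs n"
    and "A \<in> graph_matrices G" "A \<in> graph_matrices H"
  shows "G = H"
proof -
  have V: "pverts G = {1..n}" "pverts H = {1..n}"
    using G H by (auto simp: labeled_graphs_def)
  interpret G: pair_graph G using G by (simp add: labeled_graphs_def)
  interpret H: pair_graph H using H by (simp add: labeled_graphs_def)
  have "(i, j) \<in> parcs G \<longleftrightarrow> (i, j) \<in> parcs H" for i j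
  proof (cases "i \<in> {1..n} \<and> j \<in> {1..n} \<and> i \<noteq> j")
    case True
    then show ?thesis using assms(3,4) V unfolding graph_matrices_def by blast
  next
    \<comment> \<open>Loops and pairs that leave the vertex set are arcs of neither graph.\<close>
    case False
    then show ?thesis
      using V G.in_arcsD1 G.in_arcsD2 G.pair_no_loops H.in_arcsD1 H.in_arcsD2 H.pair_no_loops
      by (metis fst_conv snd_conv)
  qed
  then show ?thesis using V by (intro pair_pre_digraph.equality) auto
qed

text \<open>Choosing a matrix of minimum rank for each graph injects these graphs into
  \<open>low_rank_symmetric n m\<close>.\<close>

lemma card_low_min_rank:
  assumes "6 * n \<le> m\<^sup>2"
  shows "card {G \<in> labeled_graphs n. min_rank TYPE(bit) G + m \<le> n} * 2 ^ n \<le> 2 ^ (n choose 2)"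
proof -
  let ?B = "{G \<in> labeled_graphs n. min_rank TYPE(bit) G + m \<le> n}"
  have "\<exists>A \<in> graph_matrices G. A \<in> low_rank_symmetric n m" if "G \<in> ?B" for G
  proof -
    have "G \<in> labeled_graphs n" using that by simp
    then obtain A :: "bit mat" where A: "A \<in> graph_matrices G"
      "min_rank TYPE(bit) G = vec_space.rank n A"
      by (rule min_rank_witness)
    moreover have "card (pverts G) = n" using that by (simp add: labeled_graphs_def)
    ultimately have "A \<in> low_rank_symmetric n m"
      using that by (auto simp: low_rank_symmetric_def graph_matrices_def)
    then show ?thesis using A by blast
  qed
  then obtain F where F: "\<And>G. G \<in> ?B \<Longrightarrow> F G \<in> graph_matrices G \<and> F G \<in> low_rank_symmetric n m"
    by metis
  have "inj_on F ?B"
  proof (rule inj_onI)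
    fix G H assume GH: "G \<in> ?B" "H \<in> ?B" "F G = F H"
    then show "G = H" using graph_matrices_inj[of G n H "F G"] F[of G] F[of H] by auto
  qed
  then have "card ?B \<le> card (low_rank_symmetric n m)"
    using F card_low_rank_symmetric(1)[OF assms] by (intro card_inj_on_le[of F]) auto
  then have "card ?B * 2 ^ n \<le> card (low_rank_symmetric n m) * 2 ^ n" by simp
  also have "\<dots> \<le> 2 ^ (n choose 2)" by (rule card_low_rank_symmetric(2)[OF assms])
  finally show ?thesis .
qed

section \<open>Bounds on the average minimum rank and its limit\<close>

lemma finite_labeled_graphs: "finite (labeled_graphs n)"
  by (rule card_ge_0_finite) (simp add: card_labeled_graphs)

lemma avg_min_rank_le_1: "avg_min_rank TYPE('f::field) n \<le> 1"
proof -
  have le: "min_rank TYPE('f) G \<le> n" if G: "G \<in> labeled_graphs n" for G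
  proof -
    have "card (pverts G) = n" using G by (simp add: labeled_graphs_def)
    moreover obtain A :: "'f mat" where "A \<in> graph_matrices G"
      "min_rank TYPE('f) G = vec_space.rank n A"
      by (rule min_rank_witness[OF G])
    ultimately show ?thesis
      using vec_space.rank_le_nc[of A n n] by (simp add: graph_matrices_def)
  qed
  have "(\<Sum>G\<in>labeled_graphs n. real (min_rank TYPE('f) G)) \<le> (\<Sum>G\<in>labeled_graphs n. real n)"
    using le by (intro sum_mono) simp
  also have "\<dots> = real n * 2 ^ (n choose 2)" by (simp add: card_labeled_graphs)
  \<comment> \<open>For \<open>n = 0\<close> the denominator vanishes, and division by zero yields
    \<open>0\<close>.\<close>
  finally show ?thesis by (cases "n = 0") (simp_all add: avg_min_rank_def)
qed

text \<open>A graph outside the exceptional set has minimum rank above \<open>n - m\<close>. The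
  exceptional graphs have proportion at most \<open>1 / 2 ^ n\<close>, and each lowers the sum by at
  most \<open>n\<close>.\<close>

lemma avg_min_rank_bit_ge:
  assumes "n > 0" and m: "6 * n \<le> m\<^sup>2"
  shows "1 - real m / real n - 1 / 2 ^ n \<le> avg_min_rank TYPE(bit) n"
proof -
  let ?L = "labeled_graphs n" and ?B = "{G \<in> labeled_graphs n. min_rank TYPE(bit) G + m \<le> n}"
  define N where "N = (2 ^ (n choose 2) :: real)"
  have N: "N > 0" by (simp add: N_def)
  have "real (card ?B * 2 ^ n) \<le> real (2 ^ (n choose 2))"
    using card_low_min_rank[OF m] by (rule of_nat_mono)
  then have B: "real (card ?B) \<le> N / 2 ^ n" by (simp add: N_def field_simps)
  have "real n * N * (1 - real m / real n - 1 / 2 ^ n) = (real n - real m) * N - real n * (N / 2 ^ n)"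
    using \<open>n > 0\<close> by (simp add: field_simps)
  also have "\<dots> \<le> (real n - real m) * N - real n * real (card ?B)"
    using mult_left_mono[OF B, of "real n"] by simp
  also have "\<dots> = (\<Sum>G\<in>?L. (real n - real m) - (if G \<in> ?B then real n else 0))"
  proof -
    have "(\<Sum>G\<in>?L. if G \<in> ?B then real n else 0) = real n * real (card ?B)"
      by (subst sum.inter_restrict[symmetric])
        (simp_all add: finite_labeled_graphs Int_absorb1 Int_commute Collect_conj_eq)
    then show ?thesis by (simp add: sum_subtractf card_labeled_graphs N_def)
  qed
  \<comment> \<open>On \<open>?B\<close> the left summand is \<open>- m\<close>, hence at most any
    rank; off \<open>?B\<close> it is \<open>n - m\<close>, in real arithmetic and so possibly
    negative.\<close>
  also have "\<dots> \<le> (\<Sum>G\<in>?L. real (min_rank TYPE(bit) G))"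
    by (intro sum_mono) auto
  finally show ?thesis
    using N \<open>n > 0\<close> by (simp add: avg_min_rank_def N_def[symmetric] pos_le_divide_eq mult.commute)
qed

lemma avg_min_rank_bit_tendsto: "avg_min_rank TYPE(bit) \<longlonglongrightarrow> 1"
proof (rule tendsto_sandwich)
  let ?lower = "\<lambda>n. 1 - (sqrt (6 * real n) + 1) / real n - 1 / 2 ^ n"
  show "\<forall>\<^sub>F n in sequentially. ?lower n \<le> avg_min_rank TYPE(bit) n"
    using eventually_gt_at_top[of 0]
  proof eventually_elim
    case (elim n)
    \<comment> \<open>This is the least natural number with \<open>6 * n \<le> m\<^sup>2\<close>;
      rounding up costs the \<open>+ 1\<close> in \<open>?lower\<close>.\<close>
    define m where "m = nat \<lceil>sqrt (6 * real n)\<rceil>"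
    have m: "sqrt (6 * real n) \<le> real m" "real m \<le> sqrt (6 * real n) + 1"
      unfolding m_def by (simp_all add: real_nat_ceiling_ge)
    have "6 * real n \<le> (real m)\<^sup>2" using m(1) by (simp add: sqrt_le_D)
    then have "real (6 * n) \<le> real (m\<^sup>2)" by simp
    then have "6 * n \<le> m\<^sup>2" by (simp only: of_nat_le_iff)
    moreover have "real m / real n \<le> (sqrt (6 * real n) + 1) / real n"
      using m(2) by (rule divide_right_mono) simp
    ultimately show ?case using avg_min_rank_bit_ge[of n m] elim by simp
  qed
  show "?lower \<longlonglongrightarrow> 1" by real_asymp
  show "\<forall>\<^sub>F n in sequentially. avg_min_rank TYPE(bit) n \<le> 1"
    by (simp add: avg_min_rank_le_1)
qed (rule tendsto_const)

theorem theorem2p7: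
  shows "liminf (\<lambda>n. ereal (avg_min_rank TYPE(bit) n)) = 1 \<and>
         limsup (\<lambda>n. ereal (avg_min_rank TYPE(bit) n)) = 1"
proof -
  have "(\<lambda>n. ereal (avg_min_rank TYPE(bit) n)) \<longlonglongrightarrow> 1"
    using avg_min_rank_bit_tendsto by (simp add: one_ereal_def)
  then show ?thesis
    using lim_imp_Liminf lim_imp_Limsup trivial_limit_sequentially by blast
qed

end
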